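(* Let $n=32$ and let the cities $1,\dots,32$ be partitioned into four valleys $A=\{1,\dots,4\}$, $B=\{5,\dots,16\}$, $C=\{17,\dots,28\}$, $D=\{29,\dots,32\}$. For cities $i\neq j$ let $c_{ij}=1$ if $i$ and $j$ lie in the same valley and $c_{ij}=1000$ otherwise. Then the linear program BLP defined in the context has a feasible real-valued solution $(y,z)$ whose cost $$\sum_{s=1}^{32}\ \sum_{\substack{i,j\in\{1,\dots,32\}\\ i\neq j}} c_{ij}\, y_{i,s,j,i,s,j}$$ is strictly smaller than the minimum cost, with respect to $c$, of a travelling salesman tour (a directed Hamiltonian cycle) on the cities $1,\dots,32$. In particular, the optimal value of BLP is not equal to the optimal value of the travelling salesman problem for this instance.
   Context: Fix $n\ge 1$ and put $N=\{1,\dots,n\}$. Cities and stages are both indexed by $N$. A triple $(i,s,j)\in N^3$ stands for "travel from city $i$ to city $j$ at stage $s$". The cost of a directed Hamiltonian cycle is the sum of $c_{ij}$ over its $n$ arcs $(i,j)$. The linear program BLP has real variables $y_{i,s,j,u,p,v}$ (for all $i,s,j,u,p,v\in N$) and $z_{i,s,j,u,p,v,k,r,t}$ (for all $i,s,j,u,p,v,k,r,t\in N$), all lying in $[0,1]$. Forbidden pairs. Call the ordered pair of triples $\big((i,s,j),(u,p,v)\big)$ forbidden if at least one of the following holds: (a) $i=j$ or $u=v$; (b) $p<s$; (c) $p=s$ and $(i,j)\ne(u,v)$; (d) $p=s+1$ and $j\neq u$; (e) $p>s$ and $i=v$, except that this condition is not imposed when $s=1$ and $p=n$ (so that the last arc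 may return to the starting city of the first arc); (f) $p>s$ and $i=u$; (g) $p>s$ and $j=v$; (h) $p>s+1$ and $j=u$. A point $(y,z)$ is feasible for BLP if all variables lie in $[0,1]$ and the following constraints hold. 1. $y_{i,s,j,u,p,v}=0$ whenever $\big((i,s,j),(u,p,v)\big)$ is forbidden. Moreover $z_{i,s,j,u,p,v,k,r,t}=0$ unless $s<p<r$ and none of the three pairs $\big((i,s,j),(u,p,v)\big)$, $\big((i,s,j),(k,r,t)\big)$, $\big((u,p,v),(k,r,t)\big)$ is forbidden. 2. $\sum_{i,j\in N} y_{i,1,j,i,1,j}=1$. 3. $y_{i,s,j,i,s,j}=\sum_{u,v\in N} y_{u,1,v,i,s,j}$ for all $i,j\in N$ and $2\le s\le n$. 4. $\sum_{k\in N} y_{i,s,j,k,r,t}=\sum_{k\in N} y_{i,s,j,t,r+1,k}$ for all $i,j,t\in N$ and all $1\le s\le r\le n-1$. 5. $\sum_{k,t\in N} z_{i,s,j,u,p,v,k,r,t}=y_{i,s,j,u,p,v}$ for all $i,j,u,v\in N$ and all $1\le s<p<r\le n$. 6. $\sum_{u,v\in N} z_{i,s,j,u,p,v,k,r,t}=y_{i,s,j,k,r,t}$ for all $i,j,k,t\in N$ and all $1\le s<p<r\le n$. 7. $\sum_{i,j\in N} z_{i,s,j,u,p,v,k,r,t}=y_{u,p,v,k,r,t}$ for all $u,v,k,t\in N$ and all $1\le s<p<r\le n$. *)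

theory Defs
  imports Complex_Main
begin

section \<open>The travelling salesman problem\<close>

text \<open>A tour is represented by its set of arcs; for \<open>n = 1\<close> the only arc is a loop.\<close>

definition hamiltonian_cycle :: "nat \<Rightarrow> (nat \<times> nat) set \<Rightarrow> bool" where
  "hamiltonian_cycle n H \<longleftrightarrow>
     (\<exists>xs. distinct xs \<and> set xs = {1..n} \<and>
        H = {(xs ! k, xs ! (Suc k mod n)) |k. k < n})"

definition tour_cost :: "(nat \<Rightarrow> nat \<Rightarrow> real) \<Rightarrow> (nat \<times> nat) set \<Rightarrow> real" where
  "tour_cost c H = (\<Sum>(i, j)\<in>H. c i j)"

definition tsp_opt :: "nat \<Rightarrow> (nat \<Rightarrow> nat \<Rightarrow> real) \<Rightarrow> real" where
  "tsp_opt n c = Min {tour_cost c H |H. hamiltonian_cycle n H}"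


section \<open>The linear program BLP\<close>

text \<open>The triple \<open>(i, s, j)\<close> stands for travelling from city \<open>i\<close> to city \<open>j\<close> at stage \<open>s\<close>.\<close>

type_synonym triple = "nat \<times> nat \<times> nat"

fun forbidden :: "nat \<Rightarrow> triple \<Rightarrow> triple \<Rightarrow> bool" where
  "forbidden n (i, s, j) (u, p, v) \<longleftrightarrow>
     (i = j \<or> u = v) \<or>
     p < s \<or>
     (p = s \<and> (i, j) \<noteq> (u, v)) \<or>
     (p = s + 1 \<and> j \<noteq> u) \<or>
     (p > s \<and> i = v \<and> \<not> (s = 1 \<and> p = n)) \<or>
     (p > s \<and> i = u) \<or>
     (p > s \<and> j = v) \<or>
     (p > s + 1 \<and> j = u)"

text \<open>
  The variables are total functions; only their values at indices in \<open>{1..n}\<close> are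
  constrained, and only these values enter the constraints and the cost.
\<close>

definition blp_feasible ::
  "nat \<Rightarrow> (triple \<Rightarrow> triple \<Rightarrow> real) \<Rightarrow> (triple \<Rightarrow> triple \<Rightarrow> triple \<Rightarrow> real) \<Rightarrow> bool" where
  "blp_feasible n y z \<longleftrightarrow>
     (let N = {1..n} in
       (\<forall>i\<in>N. \<forall>s\<in>N. \<forall>j\<in>N. \<forall>u\<in>N. \<forall>p\<in>N. \<forall>v\<in>N.
          0 \<le> y (i, s, j) (u, p, v) \<and> y (i, s, j) (u, p, v) \<le> 1) \<and>
       (\<forall>i\<in>N. \<forall>s\<in>N. \<forall>j\<in>N. \<forall>u\<in>N. \<forall>p\<in>N. \<forall>v\<in>N. \<forall>k\<in>N. \<forall>r\<in>N. \<forall>t\<in>N.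
          0 \<le> z (i, s, j) (u, p, v) (k, r, t) \<and> z (i, s, j) (u, p, v) (k, r, t) \<le> 1) \<and>
       (\<forall>i\<in>N. \<forall>s\<in>N. \<forall>j\<in>N. \<forall>u\<in>N. \<forall>p\<in>N. \<forall>v\<in>N.
          forbidden n (i, s, j) (u, p, v) \<longrightarrow> y (i, s, j) (u, p, v) = 0) \<and>
       (\<forall>i\<in>N. \<forall>s\<in>N. \<forall>j\<in>N. \<forall>u\<in>N. \<forall>p\<in>N. \<forall>v\<in>N. \<forall>k\<in>N. \<forall>r\<in>N. \<forall>t\<in>N.
          \<not> (s < p \<and> p < r \<and> \<not> forbidden n (i, s, j) (u, p, v) \<and>
             \<not> forbidden n (i, s, j) (k, r, t) \<and> \<not> forbidden n (u, p, v) (k, r, t)) \<longrightarrow>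
          z (i, s, j) (u, p, v) (k, r, t) = 0) \<and>
       (\<Sum>i\<in>N. \<Sum>j\<in>N. y (i, 1, j) (i, 1, j)) = 1 \<and>
       (\<forall>i\<in>N. \<forall>j\<in>N. \<forall>s\<in>{2..n}.
          y (i, s, j) (i, s, j) = (\<Sum>u\<in>N. \<Sum>v\<in>N. y (u, 1, v) (i, s, j))) \<and>
       (\<forall>i\<in>N. \<forall>j\<in>N. \<forall>t\<in>N. \<forall>s r. 1 \<le> s \<and> s \<le> r \<and> r + 1 \<le> n \<longrightarrow>
          (\<Sum>k\<in>N. y (i, s, j) (k, r, t)) = (\<Sum>k\<in>N. y (i, s, j) (t, r + 1, k))) \<and>
       (\<forall>i\<in>N. \<forall>j\<in>N. \<forall>u\<in>N. \<forall>v\<in>N. \<forall>s p r. 1 \<le> s \<and> s < p \<and> p < r \<and> r \<le> n \<longrightarrow>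
          (\<Sum>k\<in>N. \<Sum>t\<in>N. z (i, s, j) (u, p, v) (k, r, t)) = y (i, s, j) (u, p, v)) \<and>
       (\<forall>i\<in>N. \<forall>j\<in>N. \<forall>k\<in>N. \<forall>t\<in>N. \<forall>s p r. 1 \<le> s \<and> s < p \<and> p < r \<and> r \<le> n \<longrightarrow>
          (\<Sum>u\<in>N. \<Sum>v\<in>N. z (i, s, j) (u, p, v) (k, r, t)) = y (i, s, j) (k, r, t)) \<and>
       (\<forall>u\<in>N. \<forall>v\<in>N. \<forall>k\<in>N. \<forall>t\<in>N. \<forall>s p r. 1 \<le> s \<and> s < p \<and> p < r \<and> r \<le> n \<longrightarrow>
          (\<Sum>i\<in>N. \<Sum>j\<in>N. z (i, s, j) (u, p, v) (k, r, t)) = y (u, p, v) (k, r, t)))"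

definition blp_cost ::
  "nat \<Rightarrow> (nat \<Rightarrow> nat \<Rightarrow> real) \<Rightarrow> (triple \<Rightarrow> triple \<Rightarrow> real) \<Rightarrow> real" where
  "blp_cost n c y =
     (\<Sum>s\<in>{1..n}. \<Sum>(i, j)\<in>{(i, j). i \<in> {1..n} \<and> j \<in> {1..n} \<and> i \<noteq> j}.
        c i j * y (i, s, j) (i, s, j))"

text \<open>
  The cost is bounded below on the feasible region, because all variables lie in \<open>[0, 1]\<close>,
  so the infimum is meaningful whenever a feasible point exists.
\<close>

definition blp_opt :: "nat \<Rightarrow> (nat \<Rightarrow> nat \<Rightarrow> real) \<Rightarrow> real" where
  "blp_opt n c = Inf {blp_cost n c y |y z. blp_feasible n y z}"

end

theory Submission
  imports Defs
begin

text \<open>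
  BLP never asks that every city be visited, and it only relates the (at most six) cities
  occurring in three arcs. So the walk may stay in one valley with at least six cities for all
  \<open>n\<close> stages: let the cities at any at most six of the \<open>n\<close> positions be a uniformly random
  injective choice from the valley. These local distributions have consistent marginals although
  no joint distribution on all \<open>n\<close> positions exists. The resulting cost is \<open>n\<close>, whereas every tour
  crosses between valleys.
\<close>

section \<open>Uniform injective weights\<close>

text \<open>Pairs are (position, city). Working with sets of pairs lets arcs that share a position
  merge under union; two different cities at one position violate \<open>inj_on fst\<close>, so
  contradictory arcs get weight 0.\<close>

definition inj_graph :: "'b set \<Rightarrow> ('a \<times> 'b) set \<Rightarrow> bool" where
  "inj_graph B S \<longleftrightarrow> inj_on fst S \<and> inj_on snd S \<and> snd ` S \<subseteq> B"

text \<open>The probability that a uniformly random injective map from \<open>fst ` S\<close> to \<open>B\<close> has graph \<open>S\<close>.\<close>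

definition inj_weight :: "'b set \<Rightarrow> ('a \<times> 'b) set \<Rightarrow> real" where
  "inj_weight B S = (if inj_graph B S then fact (card B - card S) / fact (card B) else 0)"

lemma inj_graph_subset: "inj_graph B S \<Longrightarrow> T \<subseteq> S \<Longrightarrow> inj_graph B T"
  unfolding inj_graph_def by (meson image_mono inj_on_subset subset_trans)

lemma inj_graphD:
  assumes "inj_graph B S" "(q, c) \<in> S" "(q', c') \<in> S"
  shows "q = q' \<longleftrightarrow> c = c'"
  using assms unfolding inj_graph_def inj_on_def by (metis fst_conv snd_conv)

lemma inj_weight_nonneg: "0 \<le> inj_weight B S"
  by (simp add: inj_weight_def)

lemma inj_weight_le_1: "inj_weight B S \<le> 1"
  by (simp add: inj_weight_def fact_mono)

lemma inj_weight_empty: "inj_weight B {} = 1"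
  by (simp add: inj_weight_def inj_graph_def)

lemma inj_weight_nonzero: "inj_weight B S \<noteq> 0 \<Longrightarrow> inj_graph B S"
  unfolding inj_weight_def by presburger

text \<open>This is the consistency of marginals. If position \<open>q\<close> already occurs in
  \<open>S\<close>, only its present city contributes. Otherwise each of the
  \<open>card B - card S\<close> free cities contributes equally, and m * (m - 1)! = m!. The bound
  on \<open>card S\<close> leaves at least one free city.\<close>

lemma sum_inj_weight_insert:
  assumes "finite N" "B \<subseteq> N" "finite S" "card S < card B"
  shows "(\<Sum>c\<in>N. inj_weight B (insert (q, c) S)) = inj_weight B S"
proof (cases "inj_graph B S")
  case False
  then have "\<not> inj_graph B (insert (q, c) S)" for c
    using inj_graph_subset by blast
  with False show ?thesis by (simp add: inj_weight_def)
next
  case True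
  show ?thesis
  proof (cases "q \<in> fst ` S")
    case True
    then obtain c0 where c0: "(q, c0) \<in> S" by force
    then have "c0 \<in> N" using \<open>inj_graph B S\<close> assms(2) by (force simp: inj_graph_def)
    have "inj_weight B (insert (q, c) S) = (if c = c0 then inj_weight B S else 0)" for c
    proof (cases "c = c0")
      case True
      then show ?thesis using c0 by (simp add: insert_absorb)
    next
      case False
      then have "\<not> inj_graph B (insert (q, c) S)"
        using inj_graphD[of B "insert (q, c) S" q c q c0] c0 by blast
      with False show ?thesis by (simp add: inj_weight_def)
    qed
    then show ?thesis using assms(1) \<open>c0 \<in> N\<close> by simp
  next
    case False
    have finB: "finite B" using assms finite_subset by blast
    have graph: "inj_graph B (insert (q, c) S) \<longleftrightarrow> c \<in> B - snd ` S" for c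
      using True False unfolding inj_graph_def by (force simp: inj_on_def)
    have "card (insert (q, c) S) = Suc (card S)" for c
      using False assms(3) by (force simp: card_insert_if)
    then have weight: "inj_weight B (insert (q, c) S)
        = (if c \<in> B - snd ` S then fact (card B - Suc (card S)) / fact (card B) else 0)" for c
      by (simp add: inj_weight_def graph)
    have card: "card (B - snd ` S) = card B - card S"
      using True finB assms(3) by (simp add: inj_graph_def card_Diff_subset card_image)
    \<comment> \<open>Naming the difference \<open>Suc d\<close> lets the factorial recursion
      \<open>fact (Suc d) = Suc d * fact d\<close> apply.\<close>
    obtain d where d: "card B - card S = Suc d" "card B - Suc (card S) = d"
      using assms(4) by (metis Suc_diff_Suc)
    have "(\<Sum>c\<in>N. inj_weight B (insert (q, c) S))
        = (\<Sum>c\<in>B - snd ` S. fact (card B - Suc (card S)) / fact (card B))"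
      unfolding weight using assms(1,2) by (intro sum.mono_neutral_cong_right) auto
    also have "\<dots> = inj_weight B S"
      using True by (simp only: sum_constant card d inj_weight_def if_True) simp
    finally show ?thesis .
  qed
qed


section \<open>A feasible point that stays in one valley\<close>

text \<open>Position \<open>s\<close> is the city left at stage \<open>s\<close>; the last arc returns to position \<open>1\<close>.\<close>

definition next_pos :: "nat \<Rightarrow> nat \<Rightarrow> nat" where
  "next_pos n s = (if s = n then 1 else Suc s)"

fun arc_graph :: "nat \<Rightarrow> triple \<Rightarrow> (nat \<times> nat) set" where
  "arc_graph n (i, s, j) = {(s, i), (next_pos n s, j)}"

text \<open>As union is idempotent, a diagonal entry is the weight of a single arc.\<close>

fun valley_y :: "nat \<Rightarrow> nat set \<Rightarrow> triple \<Rightarrow> triple \<Rightarrow> real" where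
  "valley_y n B (i, s, j) (u, p, v) =
     (if s \<le> p then inj_weight B (arc_graph n (i, s, j) \<union> arc_graph n (u, p, v)) else 0)"

fun valley_z :: "nat \<Rightarrow> nat set \<Rightarrow> triple \<Rightarrow> triple \<Rightarrow> triple \<Rightarrow> real" where
  "valley_z n B (i, s, j) (u, p, v) (k, r, t) =
     (if s < p \<and> p < r
      then inj_weight B (arc_graph n (i, s, j) \<union> arc_graph n (u, p, v) \<union> arc_graph n (k, r, t))
      else 0)"

text \<open>In an injective graph two cities agree exactly when their positions do, so every clause
  becomes a statement about stages. The exception in clause (e) is the wrap-around: for
  \<open>s < p\<close>, the position after \<open>p\<close> is \<open>s\<close> only if
  \<open>s = 1\<close> and \<open>p = n\<close>.\<close>

lemma not_forbidden:
  assumes "inj_graph B (arc_graph n (i, s, j) \<union> arc_graph n (u, p, v))"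
    and "1 \<le> s" "s \<le> p" "p \<le> n" "2 \<le> n"
  shows "\<not> forbidden n (i, s, j) (u, p, v)"
proof -
  note D = inj_graphD[OF assms(1)]
  have "s = next_pos n s \<longleftrightarrow> i = j" "p = next_pos n p \<longleftrightarrow> u = v" "s = p \<longleftrightarrow> i = u"
    "s = next_pos n p \<longleftrightarrow> i = v" "next_pos n s = p \<longleftrightarrow> j = u"
    "next_pos n s = next_pos n p \<longleftrightarrow> j = v"
    by (rule D; simp)+
  with assms(2-5) show ?thesis
    by (auto simp: next_pos_def split: if_splits)
qed

lemma sum_inj_weight_arc:
  assumes "finite N" "B \<subseteq> N" "finite S" "card S + 2 \<le> card B"
  shows "(\<Sum>i\<in>N. \<Sum>j\<in>N. inj_weight B (S \<union> arc_graph n (i, s, j))) = inj_weight B S"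
proof -
  have "S \<union> arc_graph n (i, s, j) = insert (next_pos n s, j) (insert (s, i) S)" for i j
    by auto
  moreover have "card (insert (s, i) S) < card B" for i
    using assms(3,4) by (simp add: card_insert_if)
  ultimately show ?thesis
    using assms by (simp add: sum_inj_weight_insert)
qed

lemma finite_arc_graph: "finite (arc_graph n a)"
  by (cases a) simp

lemma card_arc_graph: "card (arc_graph n a) \<le> 2"
  by (cases a) (simp add: card_insert_le_m1)

lemma card_two_arc_graphs: "card (arc_graph n a \<union> arc_graph n b) \<le> 4"
  using card_Un_le[of "arc_graph n a" "arc_graph n b"] card_arc_graph[of n a] card_arc_graph[of n b]
  by linarith

text \<open>The bound 6 comes from the sums over \<open>z\<close>: two arcs fix at most four
  positions, and summing out a third arc inserts up to two more.\<close>

lemma valley_feasible: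
  assumes B: "B \<subseteq> {1..n}" and card_B: "6 \<le> card B"
  shows "blp_feasible n (valley_y n B) (valley_z n B)"
proof -
  have n: "2 \<le> n"
    using card_mono[OF _ B] card_B by simp
  let ?N = "{1..n}"
  let ?w = "inj_weight B" and ?a = "arc_graph n"
  note sum_arc = sum_inj_weight_arc[OF finite_atLeastAtMost B]
  have arc: "(\<Sum>i\<in>?N. \<Sum>j\<in>?N. ?w (?a b \<union> ?a (i, s, j))) = ?w (?a b)" for b s
    using card_arc_graph[of n b] card_B
    by (intro sum_arc) (auto simp: finite_arc_graph)
  have arc2: "(\<Sum>i\<in>?N. \<Sum>j\<in>?N. ?w (?a b \<union> ?a c \<union> ?a (i, s, j))) = ?w (?a b \<union> ?a c)" for b c s
    using card_two_arc_graphs[of n b c] card_B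
    by (intro sum_arc) (auto simp: finite_arc_graph)
  have y_bounds: "0 \<le> valley_y n B a b \<and> valley_y n B a b \<le> 1" for a b
    by (cases a; cases b) (simp add: inj_weight_nonneg inj_weight_le_1)
  have z_bounds: "0 \<le> valley_z n B a b c \<and> valley_z n B a b c \<le> 1" for a b c
    by (cases a; cases b; cases c) (simp add: inj_weight_nonneg inj_weight_le_1)
  have y_forbidden: "valley_y n B (i, s, j) (u, p, v) = 0"
    if "s \<in> ?N" "p \<in> ?N" "forbidden n (i, s, j) (u, p, v)" for i s j u p v
  proof (rule ccontr)
    assume "valley_y n B (i, s, j) (u, p, v) \<noteq> 0"
    then have "s \<le> p" "inj_graph B (?a (i, s, j) \<union> ?a (u, p, v))"
      by (simp_all add: inj_weight_nonzero del: arc_graph.simps split: if_splits)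
    with not_forbidden[of B n i s j u p v] that n show False by auto
  qed
  have z_forbidden: "s < p \<and> p < r \<and> \<not> forbidden n (i, s, j) (u, p, v) \<and>
      \<not> forbidden n (i, s, j) (k, r, t) \<and> \<not> forbidden n (u, p, v) (k, r, t)"
    if "s \<in> ?N" "p \<in> ?N" "r \<in> ?N" "valley_z n B (i, s, j) (u, p, v) (k, r, t) \<noteq> 0"
    for i s j u p v k r t
  proof -
    have less: "s < p" "p < r"
      and "inj_graph B (?a (i, s, j) \<union> ?a (u, p, v) \<union> ?a (k, r, t))"
      using that(4) by (simp_all add: inj_weight_nonzero del: arc_graph.simps split: if_splits)
    \<comment> \<open>A graph for three arcs restricts to each two of them, which reduces the claim
      to pairs.\<close>
    then have "inj_graph B (?a (i, s, j) \<union> ?a (u, p, v))"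
      "inj_graph B (?a (i, s, j) \<union> ?a (k, r, t))" "inj_graph B (?a (u, p, v) \<union> ?a (k, r, t))"
      by (blast intro: inj_graph_subset)+
    with less that(1-3) n show ?thesis
      by (intro conjI not_forbidden) auto
  qed
  have start: "(\<Sum>i\<in>?N. \<Sum>j\<in>?N. valley_y n B (i, 1, j) (i, 1, j)) = 1"
    using sum_arc[of "{}" n 1] card_B by (simp add: inj_weight_empty)
  have diag: "valley_y n B (i, s, j) (i, s, j) =
      (\<Sum>u\<in>?N. \<Sum>v\<in>?N. valley_y n B (u, 1, v) (i, s, j))" if "1 \<le> s" for i j s
    using that arc[of "(i, s, j)" 1] by (simp add: Un_commute del: arc_graph.simps)
  have flow: "(\<Sum>k\<in>?N. valley_y n B (i, s, j) (k, r, t))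
      = (\<Sum>k\<in>?N. valley_y n B (i, s, j) (t, r + 1, k))"
    if "s \<le> r" "r + 1 \<le> n" for i s j r t
  proof -
    \<comment> \<open>Both sides fix city \<open>t\<close> at position \<open>r + 1\<close> and sum
      out one more city: at position \<open>r\<close> on the left, at the position after
      \<open>r + 1\<close> on the right. Hence both equal the weight of \<open>?S\<close>. As
      \<open>r < n\<close>, stage \<open>r\<close> does not wrap around, but stage
      \<open>r + 1\<close> may.\<close>
    let ?S = "insert (r + 1, t) (?a (i, s, j))"
    have S: "finite ?S" "card ?S < card B"
      using card_arc_graph[of n "(i, s, j)"] card_B
      by (simp_all add: card_insert_if del: arc_graph.simps add: finite_arc_graph)
    have "?a (i, s, j) \<union> ?a (k, r, t) = insert (r, k) ?S"
      "?a (i, s, j) \<union> ?a (t, r + 1, k) = insert (next_pos n (r + 1), k) ?S" for k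
      using that(2) by (auto simp: next_pos_def)
    then show ?thesis
      using that(1) sum_inj_weight_insert[OF _ B S, of r]
        sum_inj_weight_insert[OF _ B S, of "next_pos n (r + 1)"]
      by (simp del: arc_graph.simps)
  qed
  have sum3: "(\<Sum>k\<in>?N. \<Sum>t\<in>?N. valley_z n B (i, s, j) (u, p, v) (k, r, t))
      = valley_y n B (i, s, j) (u, p, v)"
    if "s < p" "p < r" for i s j u p v r
    using that arc2[of "(i, s, j)" "(u, p, v)" r] by (simp del: arc_graph.simps)
  have sum2: "(\<Sum>u\<in>?N. \<Sum>v\<in>?N. valley_z n B (i, s, j) (u, p, v) (k, r, t))
      = valley_y n B (i, s, j) (k, r, t)"
    if "s < p" "p < r" for i s j p k r t
    using that arc2[of "(i, s, j)" "(k, r, t)" p] by (simp add: ac_simps del: arc_graph.simps)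
  have sum1: "(\<Sum>i\<in>?N. \<Sum>j\<in>?N. valley_z n B (i, s, j) (u, p, v) (k, r, t))
      = valley_y n B (u, p, v) (k, r, t)"
    if "s < p" "p < r" for s u p v k r t
    using that arc2[of "(u, p, v)" "(k, r, t)" s] by (simp add: ac_simps del: arc_graph.simps)
  show ?thesis
    unfolding blp_feasible_def Let_def
  proof (intro conjI, goal_cases)
    case 1
    show ?case by (intro ballI y_bounds)
  next
    case 2
    show ?case by (intro ballI z_bounds)
  next
    case 3
    show ?case by (intro ballI impI, rule y_forbidden)
  next
    case 4
    show ?case by (intro ballI impI, rule ccontr) (use z_forbidden in blast)
  next
    case 5
    show ?case by (rule start)
  next
    case 6
    show ?case by (intro ballI diag) simp
  next
    case 7
    show ?case by (intro ballI allI impI flow) auto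
  next
    case 8
    show ?case by (intro ballI allI impI sum3) auto
  next
    case 9
    show ?case by (intro ballI allI impI sum2) auto
  next
    case 10
    show ?case by (intro ballI allI impI sum1) auto
  qed
qed

text \<open>Nonzero weight forces both ends of an arc into \<open>B\<close>, where the cost is 1,
  and the weights of all arcs at one stage sum to 1.\<close>

lemma valley_cost:
  assumes B: "B \<subseteq> {1..n}" and card_B: "2 \<le> card B"
    and unit_cost: "\<And>i j. i \<in> B \<Longrightarrow> j \<in> B \<Longrightarrow> i \<noteq> j \<Longrightarrow> c i j = 1"
  shows "blp_cost n c (valley_y n B) \<le> n"
proof -
  let ?N = "{1..n}" and ?w = "inj_weight B"
  have "(\<Sum>(i, j)\<in>{(i, j). i \<in> ?N \<and> j \<in> ?N \<and> i \<noteq> j}.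
      c i j * valley_y n B (i, s, j) (i, s, j)) \<le> 1" for s
  proof -
    have "c i j * valley_y n B (i, s, j) (i, s, j) = ?w (arc_graph n (i, s, j))" if "i \<noteq> j" for i j
    proof (cases "?w (arc_graph n (i, s, j)) = 0")
      case False
      then have "i \<in> B" "j \<in> B"
        using inj_weight_nonzero by (force simp: inj_graph_def)+
      then show ?thesis using unit_cost that by simp
    qed simp
    then have "(\<Sum>(i, j)\<in>{(i, j). i \<in> ?N \<and> j \<in> ?N \<and> i \<noteq> j}.
        c i j * valley_y n B (i, s, j) (i, s, j))
      = (\<Sum>(i, j)\<in>{(i, j). i \<in> ?N \<and> j \<in> ?N \<and> i \<noteq> j}. ?w (arc_graph n (i, s, j)))"
      by (intro sum.cong) auto
    also have "\<dots> \<le> (\<Sum>(i, j)\<in>?N \<times> ?N. ?w (arc_graph n (i, s, j)))"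
      by (intro sum_mono2) (auto simp: inj_weight_nonneg)
    also have "\<dots> = 1"
      using sum_inj_weight_arc[OF _ B, of "{}" n s] card_B
      by (simp add: inj_weight_empty sum.cartesian_product[symmetric])
    finally show ?thesis .
  qed
  then have "blp_cost n c (valley_y n B) \<le> (\<Sum>s\<in>?N. 1)"
    unfolding blp_cost_def by (rule sum_mono)
  then show ?thesis by simp
qed


section \<open>Lower bounds on costs\<close>

text \<open>Without a crossing arc, membership in \<open>A\<close> would propagate from the first
  city along the whole tour.\<close>

lemma crossing_arc:
  assumes "hamiltonian_cycle n H" "a \<in> {1..n}" "b \<in> {1..n}" "a \<in> A" "b \<notin> A"
  shows "\<exists>i j. (i, j) \<in> H \<and> (i \<in> A) \<noteq> (j \<in> A)"
proof (rule ccontr)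
  assume no_crossing: "\<not> ?thesis"
  obtain xs where xs: "distinct xs" "set xs = {1..n}"
    and H: "H = {(xs ! k, xs ! (Suc k mod n)) |k. k < n}"
    using assms(1) unfolding hamiltonian_cycle_def by blast
  have len: "length xs = n"
    using distinct_card[OF xs(1)] xs(2) by simp
  have "k < n \<Longrightarrow> xs ! k \<in> A \<longleftrightarrow> xs ! 0 \<in> A" for k
  proof (induction k)
    case (Suc k)
    then have "(xs ! k, xs ! Suc k) \<in> H" unfolding H by force
    with no_crossing Suc show ?case by auto
  qed simp
  with assms(2-5) xs(2) len show False by (metis in_set_conv_nth)
qed

lemma hamiltonian_cycle_arcs:
  assumes "hamiltonian_cycle n H" "2 \<le> n" "(i, j) \<in> H"
  shows "i \<in> {1..n}" "j \<in> {1..n}" "i \<noteq> j"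
proof -
  obtain xs k where xs: "distinct xs" "set xs = {1..n}" "k < n"
    "i = xs ! k" "j = xs ! (Suc k mod n)"
    using assms(1,3) unfolding hamiltonian_cycle_def by blast
  have len: "length xs = n"
    using distinct_card[OF xs(1)] xs(2) by simp
  have "Suc k mod n < n" "Suc k mod n \<noteq> k"
    using assms(2) xs(3) by (auto simp: mod_Suc)
  with xs len show "i \<in> {1..n}" "j \<in> {1..n}" "i \<noteq> j"
    by (metis nth_mem, metis nth_mem, metis nth_eq_iff_index_eq)
qed

text \<open>\<open>Min\<close> needs a finite nonempty set: all tours lie in one finite square, and
  visiting the cities in increasing order is a tour.\<close>

lemma tsp_opt_ge:
  assumes "2 \<le> n" and ge: "\<And>H. hamiltonian_cycle n H \<Longrightarrow> b \<le> tour_cost c H"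
  shows "b \<le> tsp_opt n c"
proof -
  let ?T = "{tour_cost c H |H. hamiltonian_cycle n H}"
  have "?T \<subseteq> tour_cost c ` Pow ({1..n} \<times> {1..n})"
    using hamiltonian_cycle_arcs(1,2)[OF _ assms(1)] by fast
  then have "finite ?T"
    by (rule finite_subset) simp
  moreover have "hamiltonian_cycle n {([1..<Suc n] ! k, [1..<Suc n] ! (Suc k mod n)) |k. k < n}"
    unfolding hamiltonian_cycle_def by (rule exI[of _ "[1..<Suc n]"]) auto
  then have "?T \<noteq> {}" by blast
  ultimately show ?thesis
    unfolding tsp_opt_def using ge by (subst Min_ge_iff) auto
qed

text \<open>Nonnegative costs make 0 a lower bound, so the real \<open>Inf\<close> is a true
  infimum.\<close>

lemma blp_opt_le:
  assumes "blp_feasible n y z"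
    and nonneg: "\<And>i j. i \<in> {1..n} \<Longrightarrow> j \<in> {1..n} \<Longrightarrow> i \<noteq> j \<Longrightarrow> 0 \<le> c i j"
  shows "blp_opt n c \<le> blp_cost n c y"
proof -
  have "0 \<le> blp_cost n c y'" if "blp_feasible n y' z'" for y' z'
  proof -
    have "\<forall>i\<in>{1..n}. \<forall>s\<in>{1..n}. \<forall>j\<in>{1..n}. \<forall>u\<in>{1..n}. \<forall>p\<in>{1..n}. \<forall>v\<in>{1..n}.
        0 \<le> y' (i, s, j) (u, p, v) \<and> y' (i, s, j) (u, p, v) \<le> 1"
      using that unfolding blp_feasible_def Let_def by (rule conjunct1)
    then have "0 \<le> y' (i, s, j) (i, s, j)"
      if "i \<in> {1..n}" "s \<in> {1..n}" "j \<in> {1..n}" for i s j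
      using that by blast
    then show ?thesis
      unfolding blp_cost_def using nonneg by (force intro!: sum_nonneg mult_nonneg_nonneg)
  qed
  then have "bdd_below {blp_cost n c y |y z. blp_feasible n y z}"
    by (intro bdd_belowI[of _ 0]) blast
  with assms(1) show ?thesis
    unfolding blp_opt_def by (intro cInf_lower) blast+
qed

theorem mainTheorem1:
  fixes A B C D :: "nat set" and c :: "nat \<Rightarrow> nat \<Rightarrow> real"
  assumes "A = {1..4}" and "B = {5..16}" and "C = {17..28}" and "D = {29..32}"
    and "\<And>i j. i \<in> {1..32} \<Longrightarrow> j \<in> {1..32} \<Longrightarrow> i \<noteq> j \<Longrightarrow>
           c i j = (if \<exists>V\<in>{A, B, C, D}. i \<in> V \<and> j \<in> V then 1 else 1000)"
  shows "(\<exists>y z. blp_feasible 32 y z \<and> blp_cost 32 c y < tsp_opt 32 c) \<and>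
         blp_opt 32 c \<noteq> tsp_opt 32 c"
proof -
  have nonneg: "0 \<le> c i j" if "i \<in> {1..32}" "j \<in> {1..32}" "i \<noteq> j" for i j
    using assms(5)[OF that] by simp
  have B: "B \<subseteq> {1..32}" "6 \<le> card B"
    by (auto simp: assms(2))
  have feasible: "blp_feasible 32 (valley_y 32 B) (valley_z 32 B)"
    using valley_feasible B by blast
  have "c i j = 1" if "i \<in> B" "j \<in> B" "i \<noteq> j" for i j
    using assms(5)[OF subsetD subsetD, OF B(1) _ B(1)] that by auto
  then have cost: "blp_cost 32 c (valley_y 32 B) \<le> 32"
    using valley_cost[of B 32 c] B by simp
  have "1000 \<le> tour_cost c H" if H: "hamiltonian_cycle 32 H" for H
  proof -
    note arcs = hamiltonian_cycle_arcs[OF H, simplified]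
    have "H \<subseteq> {1..32} \<times> {1..32}" using arcs by fastforce
    then have fin: "finite H" by (rule finite_subset) simp
    \<comment> \<open>City 1 lies in \<open>A\<close> and city 5 does not. The resulting crossing
      arc alone costs 1000, far above the 32 of the valley point.\<close>
    obtain i j where ij: "(i, j) \<in> H" "(i \<in> A) \<noteq> (j \<in> A)"
      using crossing_arc[OF H, of 1 5 A] assms(1) by auto
    have "\<not> (\<exists>V\<in>{A, B, C, D}. i \<in> V \<and> j \<in> V)"
      using ij(2) unfolding assms(1-4) by auto
    then have "c i j = 1000"
      using assms(5)[of i j] arcs[OF ij(1)] by simp
    moreover have "0 \<le> c u v" if "(u, v) \<in> H" for u v
      using nonneg arcs[OF that] by simp
    then have "(case (i, j) of (i, j) \<Rightarrow> c i j) \<le> tour_cost c H"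
      unfolding tour_cost_def using fin ij(1) by (intro member_le_sum) auto
    ultimately show ?thesis by simp
  qed
  then have "1000 \<le> tsp_opt 32 c"
    by (intro tsp_opt_ge) simp_all
  with cost have less: "blp_cost 32 c (valley_y 32 B) < tsp_opt 32 c" by simp
  moreover have "blp_opt 32 c < tsp_opt 32 c"
    using blp_opt_le[OF feasible nonneg] less by fastforce
  ultimately show ?thesis
    by (intro conjI exI) (use feasible in simp_all)
qed

end
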